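(* Let $n\ge 0$ be an integer. Then $$\sum_{i=0}^{2^n-1}(-1)^{s_2(i)}s_2(i)^r\,i^{m-r}=0\qquad\text{for all integers } 0\le r\le m<n,$$ and $$\sum_{i=0}^{2^n-1}(-1)^{s_2(i)}s_2(i)^r\,i^{n-r}=(-1)^n\,r!\,(n-r)!\,\sigma_{n-r}(1,2,\ldots,2^{n-1})\qquad\text{for all integers } 0\le r\le n,$$ where $\sigma_i$ is the $i$-th elementary symmetric polynomial in $n$ variables, evaluated here at the $n$ numbers $2^0,2^1,\ldots,2^{n-1}$.
   Context: $s_2(i)$ denotes the sum of the binary digits of $i$. The convention $0^0=1$ is used. *)

theory Defs
  imports Main
begin

text \<open>Sum of the binary digits. Since \<open>i < 2 ^ i\<close>, all digits of \<open>i\<close> at positions \<open>k \<ge> i\<close> vanish,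
  so the range \<open>k < i\<close> loses nothing.\<close>

definition s2 :: "nat \<Rightarrow> nat" where
  "s2 i = (\<Sum>k<i. i div 2 ^ k mod 2)"

text \<open>The \<open>k\<close>-th elementary symmetric polynomial in \<open>n\<close> variables, evaluated at \<open>x 0, \<dots>, x (n - 1)\<close>.
  The subsets range over indices, so repeated values count with multiplicity.\<close>

definition elem_sym :: "nat \<Rightarrow> nat \<Rightarrow> (nat \<Rightarrow> 'a::comm_semiring_1) \<Rightarrow> 'a" where
  "elem_sym n k x = (\<Sum>S | S \<subseteq> {..<n} \<and> card S = k. \<Prod>j\<in>S. x j)"

end

theory Submission
  imports Defs
begin

text \<open>
  Passing from \<open>i < 2 ^ n\<close> to \<open>i + 2 ^ n\<close> raises the digit sum by one and flips the sign. Splitting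
  the range of \<open>2 ^ Suc n\<close> numbers at its middle therefore turns the signed moment of
  \<open>s ^ r * i ^ k\<close> into the signed sum, over the lower half, of the negative finite difference
  \<open>s ^ r * i ^ k - (s + 1) ^ r * (i + 2 ^ n) ^ k\<close>, a polynomial in \<open>s\<close> and \<open>i\<close> of smaller degree.
  Each binary digit thus lowers the total degree \<open>r + k\<close> by at least one, and \<open>n\<close> digits annihilate
  everything of degree below \<open>n\<close> (\<open>signed_moment_eq_0\<close>).

  When the total degree equals the number of digits, only the top-degree part of each difference,
  \<open>- (r * s ^ (r - 1) * i ^ k + 2 ^ j * k * s ^ r * i ^ (k - 1))\<close> for the digit of weight \<open>2 ^ j\<close>,
  survives. After division by \<open>(-1) ^ n * fact r * fact k\<close>, the resulting two-term recursion is the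
  Pascal-type rule \<open>elem_sym_Suc_Suc\<close> of the elementary symmetric polynomials, with \<open>2 ^ j\<close> as the
  variable that is added (\<open>signed_moment_top\<close>).
\<close>

section \<open>Binary digit sums\<close>

lemma s2_eq_sum_digits:
  assumes "i < 2 ^ n"
  shows "s2 i = (\<Sum>k<n. i div 2 ^ k mod 2)"
proof -
  have digit_0: "i div 2 ^ k mod 2 = 0" if "i < 2 ^ m" "m \<le> k" for k m
    using that less_le_trans[OF that(1) power_increasing[OF that(2), of 2]] by simp
  have "s2 i = (\<Sum>k<max i n. i div 2 ^ k mod 2)"
    unfolding s2_def using digit_0[OF less_exp] by (intro sum.mono_neutral_left) auto
  also have "\<dots> = (\<Sum>k<n. i div 2 ^ k mod 2)"
    using digit_0[OF assms] by (intro sum.mono_neutral_right) auto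
  finally show ?thesis .
qed

lemma s2_add_power:
  assumes "i < 2 ^ n"
  shows "s2 (i + 2 ^ n) = Suc (s2 i)"
proof -
  \<comment> \<open>Below position \<open>n\<close>, the summand \<open>2 ^ n\<close> is an even multiple of \<open>2 ^ k\<close>.\<close>
  have low: "(i + 2 ^ n) div 2 ^ k mod 2 = i div 2 ^ k mod 2" if "k < n" for k
  proof -
    have "(2::nat) ^ n = 2 ^ k * (2 * 2 ^ (n - Suc k))"
      using that by (simp flip: power_Suc power_add add: Suc_diff_Suc)
    then show ?thesis
      by simp
  qed
  have "s2 (i + 2 ^ n) = (\<Sum>k<Suc n. (i + 2 ^ n) div 2 ^ k mod 2)"
    using assms by (intro s2_eq_sum_digits) simp
  also have "\<dots> = (\<Sum>k<n. i div 2 ^ k mod 2) + 1"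
    using low assms by (simp add: div_add_self2)
  finally show ?thesis
    using s2_eq_sum_digits[OF assms] by simp
qed

section \<open>Elementary symmetric polynomials\<close>

lemma elem_sym_0: "elem_sym n 0 x = 1"
proof -
  have "{S. S \<subseteq> {..<n} \<and> card S = 0} = {{}}"
    by (auto dest: finite_subset)
  then show ?thesis
    by (simp add: elem_sym_def)
qed

lemma elem_sym_eq_0:
  assumes "n < k"
  shows "elem_sym n k x = 0"
proof -
  have "{S. S \<subseteq> {..<n} \<and> card S = k} = {}"
    using assms by (auto dest!: card_mono[OF finite_lessThan])
  then show ?thesis
    unfolding elem_sym_def by (simp only: sum.empty)
qed

text \<open>The index sets are split according to whether they contain \<open>n\<close>.\<close>

lemma elem_sym_Suc_Suc:
  "elem_sym (Suc n) (Suc k) x = elem_sym n (Suc k) x + x n * elem_sym n k x"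
proof -
  let ?P = "\<lambda>m k. {S. S \<subseteq> {..<m} \<and> card S = k}"
  have fin: "finite (?P m l)" for m l :: nat
    by (rule finite_subset[of _ "Pow {..<m}"]) auto
  have fresh: "finite S \<and> n \<notin> S" if "S \<in> ?P n l" for S l
    using that finite_subset[of S "{..<n}"] by auto
  have split: "?P (Suc n) (Suc k) = ?P n (Suc k) \<union> insert n ` ?P n k"
  proof (intro equalityI subsetI)
    fix S assume S: "S \<in> ?P (Suc n) (Suc k)"
    show "S \<in> ?P n (Suc k) \<union> insert n ` ?P n k"
    proof (cases "n \<in> S")
      case True
      with S have "S - {n} \<in> ?P n k"
        by (auto simp: lessThan_Suc)
      with True show ?thesis
        by (intro UnI2 image_eqI[of _ _ "S - {n}"]) auto
    next
      case False
      with S show ?thesis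
        by (auto simp: lessThan_Suc)
    qed
  next
    fix S assume "S \<in> ?P n (Suc k) \<union> insert n ` ?P n k"
    then consider "S \<in> ?P n (Suc k)" | T where "T \<in> ?P n k" "S = insert n T"
      by blast
    then show "S \<in> ?P (Suc n) (Suc k)"
    proof cases
      case 1
      then show ?thesis
        by auto
    next
      case 2
      then show ?thesis
        using fresh[OF 2(1)] by auto
    qed
  qed
  have inj: "inj_on (insert n) (?P n k)"
  proof (rule inj_onI)
    fix S T assume "S \<in> ?P n k" "T \<in> ?P n k" "insert n S = insert n T"
    then show "S = T"
      using fresh insert_ident[of n S T] by blast
  qed
  have disj: "?P n (Suc k) \<inter> insert n ` ?P n k = {}"
    by auto
  have prod: "(\<Prod>j\<in>insert n S. x j) = x n * (\<Prod>j\<in>S. x j)" if "S \<in> ?P n k" for S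
    using fresh[OF that] by simp
  have "elem_sym (Suc n) (Suc k) x
      = (\<Sum>S\<in>?P n (Suc k). \<Prod>j\<in>S. x j) + (\<Sum>S\<in>insert n ` ?P n k. \<Prod>j\<in>S. x j)"
    unfolding elem_sym_def split by (rule sum.union_disjoint[OF fin finite_imageI[OF fin] disj])
  also have "(\<Sum>S\<in>insert n ` ?P n k. \<Prod>j\<in>S. x j) = (\<Sum>S\<in>?P n k. x n * (\<Prod>j\<in>S. x j))"
    unfolding sum.reindex[OF inj] o_def by (rule sum.cong[OF refl prod])
  finally show ?thesis
    by (simp add: elem_sym_def sum_distrib_left)
qed

section \<open>Signed moments\<close>

definition signed_moment :: "nat \<Rightarrow> nat \<Rightarrow> nat \<Rightarrow> int" where
  "signed_moment n r k = (\<Sum>i<2 ^ n. (- 1) ^ s2 i * int (s2 i) ^ r * int i ^ k)"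

lemma signed_moment_0: "signed_moment 0 r k = (if r = 0 \<and> k = 0 then 1 else 0)"
  by (auto simp: signed_moment_def s2_def)

text \<open>The upper half of the range contributes the lower half shifted by \<open>(1, 2 ^ n)\<close> in \<open>(s, i)\<close>
  with opposite sign; both shifted powers are then expanded binomially. The term at
  \<open>(a, b) = (r, k)\<close> of the double sum cancels the leading \<open>signed_moment n r k\<close>.\<close>

lemma signed_moment_Suc:
  "signed_moment (Suc n) r k = signed_moment n r k -
     (\<Sum>a\<le>r. \<Sum>b\<le>k. int (r choose a) * int (k choose b) * 2 ^ (n * (k - b)) * signed_moment n a b)"
proof -
  let ?f = "\<lambda>i. (- 1) ^ s2 i * int (s2 i) ^ r * int i ^ k"
  have expand: "?f (i + 2 ^ n) = - (\<Sum>a\<le>r. \<Sum>b\<le>k. int (r choose a) * int (k choose b) * 2 ^ (n * (k - b))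
      * ((- 1) ^ s2 i * int (s2 i) ^ a * int i ^ b))" if "i < 2 ^ n" for i
  proof -
    have "?f (i + 2 ^ n) = - ((- 1) ^ s2 i * ((int (s2 i) + 1) ^ r * (int i + 2 ^ n) ^ k))"
      using s2_add_power[OF that] by (simp add: add.commute)
    also have "(int (s2 i) + 1) ^ r * (int i + 2 ^ n) ^ k
        = (\<Sum>a\<le>r. \<Sum>b\<le>k. (int (r choose a) * int (s2 i) ^ a) *
             (int (k choose b) * int i ^ b * 2 ^ (n * (k - b))))"
      by (simp add: binomial_ring sum_product power_mult)
    finally show ?thesis
      by (simp add: sum_distrib_left mult_ac)
  qed
  have halves: "{..<(2::nat) ^ Suc n} = {..<2 ^ n} \<union> {2 ^ n..<2 ^ n + 2 ^ n}"
    by auto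
  have "signed_moment (Suc n) r k = (\<Sum>i<2 ^ n. ?f i) + (\<Sum>i\<in>{2 ^ n..<2 ^ n + 2 ^ n}. ?f i)"
    unfolding signed_moment_def halves by (rule sum.union_disjoint) auto
  also have "(\<Sum>i\<in>{2 ^ n..<2 ^ n + 2 ^ n}. ?f i) = (\<Sum>i<2 ^ n. ?f (i + 2 ^ n))"
    using sum.shift_bounds_nat_ivl[of ?f 0 "2 ^ n" "2 ^ n"] by (simp add: atLeast0LessThan)
  also have "\<dots> = - (\<Sum>i<2 ^ n. \<Sum>a\<le>r. \<Sum>b\<le>k. int (r choose a) * int (k choose b) * 2 ^ (n * (k - b))
      * ((- 1) ^ s2 i * int (s2 i) ^ a * int i ^ b))"
    by (subst sum_negf[symmetric]) (intro sum.cong refl expand, simp)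
  also have "(\<Sum>i<2 ^ n. \<Sum>a\<le>r. \<Sum>b\<le>k. int (r choose a) * int (k choose b) * 2 ^ (n * (k - b))
      * ((- 1) ^ s2 i * int (s2 i) ^ a * int i ^ b))
    = (\<Sum>a\<le>r. \<Sum>b\<le>k. int (r choose a) * int (k choose b) * 2 ^ (n * (k - b)) * signed_moment n a b)"
    unfolding signed_moment_def sum_distrib_left
    by (rule trans[OF sum.swap]) (rule sum.cong[OF refl sum.swap])
  finally show ?thesis
    by (simp add: signed_moment_def)
qed

text \<open>By induction, among the terms of the binomial expansion only the leading one can be nonzero, and
  it cancels.\<close>

lemma signed_moment_eq_0: "r + k < n \<Longrightarrow> signed_moment n r k = 0"
proof (induction n arbitrary: r k)
  case (Suc n)
  have "int (r choose a) * int (k choose b) * 2 ^ (n * (k - b)) * signed_moment n a b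
      = (if r = a then if k = b then signed_moment n r k else 0 else 0)"
    if "a \<le> r" "b \<le> k" for a b
    using Suc.IH[of a b] Suc.prems that by auto
  then have "(\<Sum>a\<le>r. \<Sum>b\<le>k. int (r choose a) * int (k choose b) * 2 ^ (n * (k - b)) * signed_moment n a b)
      = (\<Sum>a\<le>r. \<Sum>b\<le>k. if r = a then if k = b then signed_moment n r k else 0 else 0)"
    by (intro sum.cong refl) auto
  also have "\<dots> = (\<Sum>a\<le>r. if r = a then signed_moment n r k else 0)"
    by (intro sum.cong refl) simp
  finally show ?case
    by (simp add: signed_moment_Suc)
qed simp

text \<open>In the binomial expansion the leading term cancels and the terms of degree below \<open>n\<close> vanish by
  \<open>signed_moment_eq_0\<close>, which leaves the two of degree \<open>n\<close>. For \<open>r = 0\<close> or \<open>k = 0\<close> the truncated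
  index \<open>r - 1\<close> or \<open>k - 1\<close> is harmless because of the factor in front.\<close>

lemma signed_moment_Suc_top:
  assumes "r + k = Suc n"
  shows "signed_moment (Suc n) r k
    = - (int r * signed_moment n (r - 1) k + int k * 2 ^ n * signed_moment n r (k - 1))"
proof -
  let ?t = "\<lambda>a b. int (r choose a) * int (k choose b) * 2 ^ (n * (k - b)) * signed_moment n a b"
  \<comment> \<open>The nested conditionals let \<open>sum.delta\<close> collapse the double sum one index at a time.\<close>
  let ?top = "\<lambda>a b. if r = a then if k = b then signed_moment n r k else 0 else 0"
  let ?dr = "\<lambda>a b. if r - 1 = a then if k = b then int r * signed_moment n (r - 1) k else 0 else 0"
  let ?dk = "\<lambda>a b. if r = a then if k - 1 = b then int k * 2 ^ n * signed_moment n r (k - 1) else 0 else 0"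
  have "?t a b = ?top a b + ?dr a b + ?dk a b" if ab: "a \<le> r" "b \<le> k" for a b
  proof -
    consider "a = r" "b = k" | "Suc a = r" "b = k" | "a = r" "Suc b = k" | "a + b < n"
      using ab assms by linarith
    then show ?thesis
    proof cases
      case 1
      then show ?thesis by (cases r; cases k) auto
    next
      case 2
      then show ?thesis by auto
    next
      case 3
      then show ?thesis by auto
    next
      case 4
      then show ?thesis
        using assms signed_moment_eq_0[OF 4] by auto
    qed
  qed
  then have "(\<Sum>a\<le>r. \<Sum>b\<le>k. ?t a b) = (\<Sum>a\<le>r. \<Sum>b\<le>k. ?top a b + ?dr a b + ?dk a b)"
    by (intro sum.cong refl) auto
  also have "\<dots> = (\<Sum>a\<le>r. (if r = a then signed_moment n r k else 0)
      + (if r - 1 = a then int r * signed_moment n (r - 1) k else 0)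
      + (if r = a then int k * 2 ^ n * signed_moment n r (k - 1) else 0))"
    by (intro sum.cong refl) (simp add: sum.distrib)
  also have "\<dots> = signed_moment n r k
      + (int r * signed_moment n (r - 1) k + int k * 2 ^ n * signed_moment n r (k - 1))"
    by (simp add: sum.distrib)
  finally show ?thesis
    by (simp add: signed_moment_Suc)
qed

lemma signed_moment_top:
  "r + k = n \<Longrightarrow> signed_moment n r k = (- 1) ^ n * fact r * fact k * elem_sym n k (\<lambda>j. 2 ^ j)"
proof (induction n arbitrary: r k)
  case 0
  then show ?case
    by (simp add: signed_moment_0 elem_sym_0)
next
  case (Suc n)
  let ?e = "\<lambda>n k. elem_sym n k (\<lambda>j. 2 ^ j) :: int"
  have dr: "int r * signed_moment n (r - 1) k = (- 1) ^ n * fact r * fact k * ?e n k"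
  proof (cases r)
    case 0
    then show ?thesis
      using Suc.prems by (simp add: elem_sym_eq_0)
  next
    case (Suc r')
    then show ?thesis
      using Suc.IH[of r' k] Suc.prems by (simp add: algebra_simps)
  qed
  show ?case
  proof (cases k)
    case 0
    then show ?thesis
      using signed_moment_Suc_top[OF Suc.prems] dr by (simp add: elem_sym_0)
  next
    case k: (Suc k')
    have "int k * signed_moment n r (k - 1) = (- 1) ^ n * fact r * fact k * ?e n k'"
      using Suc.IH[of r k'] Suc.prems k by (simp add: algebra_simps)
    then have "int k * 2 ^ n * signed_moment n r (k - 1) = (- 1) ^ n * fact r * fact k * (2 ^ n * ?e n k')"
      by (simp add: mult_ac)
    then have "signed_moment (Suc n) r k = (- 1) ^ Suc n * fact r * fact k * (?e n k + 2 ^ n * ?e n k')"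
      unfolding signed_moment_Suc_top[OF Suc.prems] dr by (simp add: distrib_left)
    then show ?thesis
      unfolding k elem_sym_Suc_Suc .
  qed
qed

theorem corollary2p13:
  fixes n :: nat
  shows "(\<forall>m r :: nat. r \<le> m \<and> m < n \<longrightarrow>
            (\<Sum>i = 0..2 ^ n - 1. (- 1) ^ s2 i * int (s2 i) ^ r * int i ^ (m - r)) = 0)
       \<and> (\<forall>r :: nat. r \<le> n \<longrightarrow>
            (\<Sum>i = 0..2 ^ n - 1. (- 1) ^ s2 i * int (s2 i) ^ r * int i ^ (n - r))
              = (- 1) ^ n * fact r * fact (n - r) * elem_sym n (n - r) (\<lambda>j. 2 ^ j))"
proof -
  have "{0..2 ^ n - 1} = {..<(2::nat) ^ n}"
    by (simp flip: atLeast0LessThan atLeastLessThanSuc_atLeastAtMost)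
  then have "(\<Sum>i = 0..2 ^ n - 1. (- 1) ^ s2 i * int (s2 i) ^ r * int i ^ k) = signed_moment n r k" for r k
    by (simp add: signed_moment_def)
  then show ?thesis
    by (simp add: signed_moment_eq_0 signed_moment_top)
qed

end
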